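(* Let $\Omega\subset\mathbb{R}^3$ be a domain, let $v:\Omega\to\mathbb{C}$ be a function, and let $\varphi:\Omega\to\mathbb{C}$ be a twice continuously differentiable scalar function that does not vanish anywhere in $\Omega$. Then $\varphi$ is a solution of the Schrödinger equation $$\triangle\varphi+v\varphi=0 \quad\text{in }\Omega$$ if and only if the vector function $\overrightarrow{f}:=\check{\partial}\varphi=\varphi^{-1}D\varphi$ is a solution of $$D\overrightarrow{f}+\overrightarrow{f}^{2}=v\quad\text{in }\Omega .$$
   Context: $\mathbb{H}(\mathbb{C})$ denotes the complex quaternions: elements $a=\sum_{k=0}^{3}a_k i_k$ with $a_k\in\mathbb{C}$, where $i_0=1$ is the unit, $i_k^2=-1$ for $k=1,2,3$, $i_1i_2=-i_2i_1=i_3$, $i_2i_3=-i_3i_2=i_1$, $i_3i_1=-i_1i_3=i_2$, and the complex unit $i$ commutes with every $i_k$. Scalars are identified with multiples of $i_0$; a vector (purely vectorial quaternion) is $\overrightarrow{a}=\sum_{k=1}^{3}a_k i_k$. The quaternionic square of a vector is $\overrightarrow{a}^2=-(a_1^2+a_2^2+a_3^2)$ (no complex conjugation). For a differentiable function $g:\Omega\to\mathbb{H}(\mathbb{C})$, the Moisil-Theodoresco operator is $Dg=\sum_{k=1}^{3}i_k\,\partial_k g$ with $\partial_k=\partial/\partial x_k$; for a scalar function $u$, $Du=\operatorname{grad}u=\sum_{k=1}^3 i_k\partial_k u$, and for a vector function, $D\overrightarrow{g}=-\operatorname{div}\overrightarrow{g}+\operatorname{rot}\overrightarrow{g}$ ($\operatorname{rot}$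 is the curl). The logarithmic derivative of a nowhere vanishing scalar function $u$ is $\check{\partial}u=u^{-1}Du$. $\triangle$ is the three-dimensional Laplacian. *)

theory Defs
  imports "HOL-Analysis.Analysis"
begin

section \<open>Complex quaternions\<close>

text \<open>
  \<open>CQuat a\<^sub>0 a\<^sub>1 a\<^sub>2 a\<^sub>3\<close> is \<open>a\<^sub>0 + a\<^sub>1 i\<^sub>1 + a\<^sub>2 i\<^sub>2 + a\<^sub>3 i\<^sub>3\<close> with complex \<open>a\<^sub>k\<close>; the complex unit
  commutes with every \<open>i\<^sub>k\<close>. The norm is the Hermitian one, which is not multiplicative; it serves
  only to fix the (unique) vector space topology in which derivatives are taken.
\<close>

codatatype cquat = CQuat (Q0: complex) (Q1: complex) (Q2: complex) (Q3: complex)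

lemma cquat_eqI [intro?]:
  "\<lbrakk>Q0 p = Q0 q; Q1 p = Q1 q; Q2 p = Q2 q; Q3 p = Q3 q\<rbrakk> \<Longrightarrow> p = q"
  by (rule cquat.expand) simp

lemma cquat_eq_iff:
  "p = q \<longleftrightarrow> Q0 p = Q0 q \<and> Q1 p = Q1 q \<and> Q2 p = Q2 q \<and> Q3 p = Q3 q"
  by (auto intro: cquat.expand)

instantiation cquat :: ab_group_add
begin

primcorec zero_cquat where
  "Q0 0 = 0" | "Q1 0 = 0" | "Q2 0 = 0" | "Q3 0 = 0"

primcorec plus_cquat where
  "Q0 (p + q) = Q0 p + Q0 q"
| "Q1 (p + q) = Q1 p + Q1 q"
| "Q2 (p + q) = Q2 p + Q2 q"
| "Q3 (p + q) = Q3 p + Q3 q"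

primcorec uminus_cquat where
  "Q0 (- p) = - Q0 p" | "Q1 (- p) = - Q1 p" | "Q2 (- p) = - Q2 p" | "Q3 (- p) = - Q3 p"

primcorec minus_cquat where
  "Q0 (p - q) = Q0 p - Q0 q"
| "Q1 (p - q) = Q1 p - Q1 q"
| "Q2 (p - q) = Q2 p - Q2 q"
| "Q3 (p - q) = Q3 p - Q3 q"

instance
  by standard (simp_all add: cquat_eq_iff)

end

instantiation cquat :: real_algebra_1
begin

primcorec one_cquat where
  "Q0 1 = 1" | "Q1 1 = 0" | "Q2 1 = 0" | "Q3 1 = 0"

primcorec times_cquat where
  "Q0 (p * q) = Q0 p * Q0 q - Q1 p * Q1 q - Q2 p * Q2 q - Q3 p * Q3 q"
| "Q1 (p * q) = Q0 p * Q1 q + Q1 p * Q0 q + Q2 p * Q3 q - Q3 p * Q2 q"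
| "Q2 (p * q) = Q0 p * Q2 q - Q1 p * Q3 q + Q2 p * Q0 q + Q3 p * Q1 q"
| "Q3 (p * q) = Q0 p * Q3 q + Q1 p * Q2 q - Q2 p * Q1 q + Q3 p * Q0 q"

primcorec scaleR_cquat where
  "Q0 (r *\<^sub>R q) = r *\<^sub>R Q0 q"
| "Q1 (r *\<^sub>R q) = r *\<^sub>R Q1 q"
| "Q2 (r *\<^sub>R q) = r *\<^sub>R Q2 q"
| "Q3 (r *\<^sub>R q) = r *\<^sub>R Q3 q"

instance
  by standard (simp_all add: cquat_eq_iff algebra_simps)

end

instantiation cquat :: real_normed_vector
begin

definition norm_cquat :: "cquat \<Rightarrow> real" where
  "norm q = sqrt ((cmod (Q0 q))\<^sup>2 + (cmod (Q1 q))\<^sup>2 + (cmod (Q2 q))\<^sup>2 + (cmod (Q3 q))\<^sup>2)"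

definition sgn_cquat :: "cquat \<Rightarrow> cquat" where
  "sgn q = q /\<^sub>R norm q" for q :: cquat

definition dist_cquat :: "cquat \<Rightarrow> cquat \<Rightarrow> real" where
  "dist p q = norm (p - q)" for p q :: cquat

definition uniformity_cquat :: "(cquat \<times> cquat) filter" where
  "(uniformity :: (cquat \<times> cquat) filter) = (INF e\<in>{0 <..}. principal {(x, y). dist x y < e})"

definition open_cquat :: "cquat set \<Rightarrow> bool" where
  "open U \<longleftrightarrow> (\<forall>x\<in>U. eventually (\<lambda>(x', y). x' = x \<longrightarrow> y \<in> U) uniformity)"
  for U :: "cquat set"

lemma norm_cquat_tuple: "norm q = norm (Q0 q, Q1 q, Q2 q, Q3 q)" for q :: cquat
  by (simp add: norm_cquat_def norm_Pair add.assoc)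

instance
proof
  fix r :: real and p q :: cquat
  show "norm q = 0 \<longleftrightarrow> q = 0"
    by (simp add: norm_cquat_tuple cquat_eq_iff zero_prod_def)
  show "norm (p + q) \<le> norm p + norm q"
    using norm_triangle_ineq[of "(Q0 p, Q1 p, Q2 p, Q3 p)" "(Q0 q, Q1 q, Q2 q, Q3 q)"]
    by (simp add: norm_cquat_tuple)
  show "norm (r *\<^sub>R q) = \<bar>r\<bar> * norm q"
    using norm_scaleR[of r "(Q0 q, Q1 q, Q2 q, Q3 q)"]
    by (simp add: norm_cquat_tuple)
qed (simp_all add: sgn_cquat_def dist_cquat_def uniformity_cquat_def open_cquat_def)

end

definition i1 :: cquat where "i1 = CQuat 0 1 0 0"
definition i2 :: cquat where "i2 = CQuat 0 0 1 0"
definition i3 :: cquat where "i3 = CQuat 0 0 0 1"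

lemma unit_products:
  "i1 * i1 = -1" "i2 * i2 = -1" "i3 * i3 = -1"
  "i1 * i2 = i3" "i2 * i1 = - i3"
  "i2 * i3 = i1" "i3 * i2 = - i1"
  "i3 * i1 = i2" "i1 * i3 = - i2"
  by (simp_all add: i1_def i2_def i3_def cquat_eq_iff)

definition cq_scalar :: "complex \<Rightarrow> cquat" where
  "cq_scalar c = CQuat c 0 0 0"

lemma cq_scalar_sel [simp]:
  "Q0 (cq_scalar c) = c" "Q1 (cq_scalar c) = 0" "Q2 (cq_scalar c) = 0" "Q3 (cq_scalar c) = 0"
  by (simp_all add: cq_scalar_def)

lemma cquat_expand:
  "q = cq_scalar (Q0 q) + cq_scalar (Q1 q) * i1 + cq_scalar (Q2 q) * i2 + cq_scalar (Q3 q) * i3"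
  by (simp add: cquat_eq_iff i1_def i2_def i3_def)

lemma cq_scalar_commute: "cq_scalar c * q = q * cq_scalar c"
  by (simp add: cquat_eq_iff mult.commute)

lemma vector_square:
  "Q0 q = 0 \<Longrightarrow> q\<^sup>2 = cq_scalar (- ((Q1 q)\<^sup>2 + (Q2 q)\<^sup>2 + (Q3 q)\<^sup>2))"
  by (simp add: cquat_eq_iff power2_eq_square)

lemma bounded_linear_cq_scalar: "bounded_linear cq_scalar"
  by (rule bounded_linear_intro[of _ 1])
    (simp_all add: cquat_eq_iff norm_cquat_def)


section \<open>Differential operators on three-dimensional space\<close>

definition partial :: "3 \<Rightarrow> (real^3 \<Rightarrow> 'a::real_normed_vector) \<Rightarrow> real^3 \<Rightarrow> 'a" where
  "partial k f x = vector_derivative (\<lambda>t. f (x + t *\<^sub>R axis k 1)) (at 0)"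

definition has_partials_on :: "(real^3) set \<Rightarrow> (real^3 \<Rightarrow> 'a::real_normed_vector) \<Rightarrow> bool" where
  "has_partials_on S f \<longleftrightarrow> (\<forall>k. \<forall>x\<in>S. (\<lambda>t. f (x + t *\<^sub>R axis k 1)) differentiable (at 0))"

text \<open>The next two notions are meant for open sets.\<close>

definition C1_on :: "(real^3) set \<Rightarrow> (real^3 \<Rightarrow> 'a::real_normed_vector) \<Rightarrow> bool" where
  "C1_on S f \<longleftrightarrow> has_partials_on S f \<and> (\<forall>k. continuous_on S (partial k f))"

definition C2_on :: "(real^3) set \<Rightarrow> (real^3 \<Rightarrow> 'a::real_normed_vector) \<Rightarrow> bool" where
  "C2_on S f \<longleftrightarrow> C1_on S f \<and> (\<forall>k. C1_on S (partial k f))"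

definition laplacian :: "(real^3 \<Rightarrow> 'a::real_normed_vector) \<Rightarrow> real^3 \<Rightarrow> 'a" where
  "laplacian f x = (\<Sum>k\<in>UNIV. partial k (partial k f) x)"

definition moisil_D :: "(real^3 \<Rightarrow> cquat) \<Rightarrow> real^3 \<Rightarrow> cquat" where
  "moisil_D g x = i1 * partial 1 g x + i2 * partial 2 g x + i3 * partial 3 g x"

definition log_deriv :: "(real^3 \<Rightarrow> complex) \<Rightarrow> real^3 \<Rightarrow> cquat" where
  "log_deriv u x = cq_scalar (inverse (u x)) * moisil_D (\<lambda>y. cq_scalar (u y)) x"

lemma partial_cq_scalar:
  assumes "has_partials_on S u" "x \<in> S"
  shows "partial k (\<lambda>y. cq_scalar (u y)) x = cq_scalar (partial k u x)"
proof -
  have "((\<lambda>t. u (x + t *\<^sub>R axis k 1)) has_vector_derivative partial k u x) (at 0)"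
    using assms unfolding has_partials_on_def partial_def
    by (simp add: vector_derivative_works)
  from bounded_linear.has_vector_derivative[OF bounded_linear_cq_scalar this]
  show ?thesis
    unfolding partial_def by (rule vector_derivative_at)
qed

lemma log_deriv_components:
  assumes "has_partials_on S u" "x \<in> S"
  shows "log_deriv u x =
    CQuat 0 (partial 1 u x / u x) (partial 2 u x / u x) (partial 3 u x / u x)"
  by (simp add: log_deriv_def moisil_D_def partial_cq_scalar[OF assms] cquat_eq_iff
      i1_def i2_def i3_def divide_inverse mult.commute)

end

theory Submission
  imports Defs
begin

text \<open>
  For \<open>f = \<phi>\<^sup>-\<^sup>1 D\<phi>\<close> the quotient rule gives \<open>- div f + f\<^sup>2 = - \<triangle>\<phi> / \<phi>\<close>, because the terms
  \<open>(\<partial>\<^sub>k\<phi> / \<phi>)\<^sup>2\<close> cancel, and \<open>rot f = 0\<close> by the symmetry of second derivatives. The latter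
  holds since both mixed partials are limits of the same second difference quotient.
\<close>

text \<open>\<open>partial\<close> differentiates at parameter 0 only, while the mean value theorem
  needs a derivative all along a segment. Composing with the shift \<open>s - t\<close> moves the
  base point along the line.\<close>

lemma has_vector_derivative_partial:
  assumes "has_partials_on S f" "x + t *\<^sub>R axis k 1 \<in> S"
  shows "((\<lambda>s. f (x + s *\<^sub>R axis k 1)) has_vector_derivative
          partial k f (x + t *\<^sub>R axis k 1)) (at t)"
proof -
  have "((\<lambda>s. f (x + t *\<^sub>R axis k 1 + s *\<^sub>R axis k 1)) has_vector_derivative
          partial k f (x + t *\<^sub>R axis k 1)) (at 0)"
    using assms unfolding has_partials_on_def partial_def by (simp add: vector_derivative_works)
  moreover have "((\<lambda>s. s - t) has_vector_derivative 1) (at t)"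
    by (auto intro!: derivative_eq_intros)
  ultimately have "((\<lambda>s. f (x + t *\<^sub>R axis k 1 + s *\<^sub>R axis k 1)) \<circ> (\<lambda>s. s - t)
      has_vector_derivative 1 *\<^sub>R partial k f (x + t *\<^sub>R axis k 1)) (at t)"
    by (intro vector_diff_chain_at) auto
  then show ?thesis
    by (simp add: o_def algebra_simps)
qed

text \<open>Two uses of the mean value theorem, first along \<open>k\<close> and then along
  \<open>j\<close>, turn the second difference into a mixed partial at an interior point of the
  square. The inner product with \<open>b\<close> makes everything real valued, since the theorem
  fails for complex-valued functions.\<close>

lemma second_difference_mean_value:
  fixes f :: "real^3 \<Rightarrow> 'a::real_inner"
  assumes h: "0 < h"
    and f: "has_partials_on S f" and fk: "has_partials_on S (partial k f)"
    and S: "\<And>s t. 0 \<le> s \<Longrightarrow> s \<le> h \<Longrightarrow> 0 \<le> t \<Longrightarrow> t \<le> h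
                \<Longrightarrow> x + s *\<^sub>R axis j 1 + t *\<^sub>R axis k 1 \<in> S"
  obtains s t where "0 < s" "s < h" "0 < t" "t < h"
    "(f (x + h *\<^sub>R axis j 1 + h *\<^sub>R axis k 1) - f (x + h *\<^sub>R axis j 1)
        - f (x + h *\<^sub>R axis k 1) + f x) \<bullet> b
     = h\<^sup>2 * (partial j (partial k f) (x + s *\<^sub>R axis j 1 + t *\<^sub>R axis k 1) \<bullet> b)"
proof -
  \<comment> \<open>The increment over \<open>h\<close> in direction \<open>j\<close>, as a function
    of the position in direction \<open>k\<close>; its own increment \<open>G h - G 0\<close> is the
    second difference.\<close>
  define G where
    "G t = (f (x + h *\<^sub>R axis j 1 + t *\<^sub>R axis k 1) - f (x + t *\<^sub>R axis k 1)) \<bullet> b" for t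
  have dG: "(G has_real_derivative
      (partial k f (x + h *\<^sub>R axis j 1 + t *\<^sub>R axis k 1) - partial k f (x + t *\<^sub>R axis k 1)) \<bullet> b) (at t)"
    if "0 \<le> t" "t \<le> h" for t
    unfolding G_def has_real_derivative_iff_has_vector_derivative
    using S[of h t] S[of 0 t] that h
    by (intro bounded_linear.has_vector_derivative[OF bounded_linear_inner_left]
        has_vector_derivative_diff has_vector_derivative_partial[OF f]) auto
  obtain t where t: "0 < t" "t < h" and Gt: "G h - G 0 = (h - 0) *
      ((partial k f (x + h *\<^sub>R axis j 1 + t *\<^sub>R axis k 1) - partial k f (x + t *\<^sub>R axis k 1)) \<bullet> b)"
    using MVT2[OF h dG] by blast
  \<comment> \<open>With \<open>t\<close> fixed by the first application, the derivative of
    \<open>G\<close> at \<open>t\<close> is exactly \<open>H h - H 0\<close>.\<close>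
  define H where "H s = partial k f (x + t *\<^sub>R axis k 1 + s *\<^sub>R axis j 1) \<bullet> b" for s
  have dH: "(H has_real_derivative
      partial j (partial k f) (x + t *\<^sub>R axis k 1 + s *\<^sub>R axis j 1) \<bullet> b) (at s)"
    if "0 \<le> s" "s \<le> h" for s
    unfolding H_def has_real_derivative_iff_has_vector_derivative
    using S[of s t] that t
    by (intro bounded_linear.has_vector_derivative[OF bounded_linear_inner_left]
        has_vector_derivative_partial[OF fk]) (auto simp: add_ac)
  obtain s where s: "0 < s" "s < h" and Hs: "H h - H 0 = (h - 0) *
      (partial j (partial k f) (x + t *\<^sub>R axis k 1 + s *\<^sub>R axis j 1) \<bullet> b)"
    using MVT2[OF h dH] by blast
  have "G h - G 0 = h * (H h - H 0)"
    using Gt by (simp add: H_def inner_diff_left add_ac)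
  with Hs have "G h - G 0 = h\<^sup>2 *
      (partial j (partial k f) (x + s *\<^sub>R axis j 1 + t *\<^sub>R axis k 1) \<bullet> b)"
    by (simp add: power2_eq_square add_ac)
  moreover have "G h - G 0 = (f (x + h *\<^sub>R axis j 1 + h *\<^sub>R axis k 1) - f (x + h *\<^sub>R axis j 1)
        - f (x + h *\<^sub>R axis k 1) + f x) \<bullet> b"
    by (simp add: G_def algebra_simps)
  ultimately show thesis
    using that s t by metis
qed

lemma partial_commute:
  fixes f :: "real^3 \<Rightarrow> 'a::real_inner"
  assumes "open S" "C2_on S f" "x \<in> S"
  shows "partial j (partial k f) x = partial k (partial j f) x"
proof -
  \<comment> \<open>Testing against the difference of the two sides suffices: equality of the two
    inner products at \<open>x\<close> then reads \<open>b \<bullet> b = 0\<close>.\<close>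
  define b where "b = partial j (partial k f) x - partial k (partial j f) x"
  define P where "P y = partial j (partial k f) y \<bullet> b" for y
  define Q where "Q y = partial k (partial j f) y \<bullet> b" for y
  have f: "has_partials_on S f" "has_partials_on S (partial k f)" "has_partials_on S (partial j f)"
    using assms(2) by (auto simp: C2_on_def C1_on_def)
  have "continuous_on S (partial j (partial k f))" "continuous_on S (partial k (partial j f))"
    using assms(2) by (auto simp: C2_on_def C1_on_def)
  then have cont: "isCont P x" "isCont Q x"
    unfolding P_def Q_def using assms(1,3)
    by (auto simp: continuous_on_eq_continuous_at intro!: continuous_intros)
  have "\<bar>P x - Q x\<bar> \<le> e" if "0 < e" for e
  proof -
    have ev: "\<forall>\<^sub>F y in nhds x. y \<in> S \<and> dist (P y) (P x) < e / 2 \<and> dist (Q y) (Q x) < e / 2"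
      using assms(1,3) cont that
      by (intro eventually_conj eventually_nhds_in_open tendstoD)
        (auto simp: isCont_def tendsto_at_iff_tendsto_nhds)
    then obtain d where d: "0 < d" and
      near: "\<And>y. dist y x < d \<Longrightarrow> y \<in> S \<and> dist (P y) (P x) < e / 2 \<and> dist (Q y) (Q x) < e / 2"
      unfolding eventually_nhds_metric by blast
    \<comment> \<open>Two displacements of length at most \<open>d / 3\<close> stay strictly within
      distance \<open>d\<close> of \<open>x\<close>.\<close>
    define h where "h = d / 3"
    have h: "0 < h" using d by (simp add: h_def)
    have box: "dist (x + s *\<^sub>R axis l 1 + t *\<^sub>R axis m 1) x < d"
      if "0 \<le> s" "s \<le> h" "0 \<le> t" "t \<le> h" for s t and l m :: 3
    proof -
      have "dist (x + s *\<^sub>R axis l 1 + t *\<^sub>R axis m 1) x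
          \<le> norm (s *\<^sub>R axis l 1 :: real^3) + norm (t *\<^sub>R axis m 1 :: real^3)"
        unfolding dist_norm add.assoc add_diff_cancel_left' by (rule norm_triangle_ineq)
      also have "\<dots> < d" using that d by (simp add: h_def)
      finally show ?thesis .
    qed
    obtain s t where st: "0 < s" "s < h" "0 < t" "t < h"
      "(f (x + h *\<^sub>R axis j 1 + h *\<^sub>R axis k 1) - f (x + h *\<^sub>R axis j 1)
        - f (x + h *\<^sub>R axis k 1) + f x) \<bullet> b = h\<^sup>2 * P (x + s *\<^sub>R axis j 1 + t *\<^sub>R axis k 1)"
      using second_difference_mean_value[OF h f(1,2), of x j b] near box
      unfolding P_def by metis
    obtain s' t' where st': "0 < s'" "s' < h" "0 < t'" "t' < h"
      "(f (x + h *\<^sub>R axis k 1 + h *\<^sub>R axis j 1) - f (x + h *\<^sub>R axis k 1)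
        - f (x + h *\<^sub>R axis j 1) + f x) \<bullet> b = h\<^sup>2 * Q (x + s' *\<^sub>R axis k 1 + t' *\<^sub>R axis j 1)"
      using second_difference_mean_value[OF h f(1,3), of x k b] near box
      unfolding Q_def by metis
    \<comment> \<open>The second difference is symmetric in \<open>j\<close> and \<open>k\<close>,
      so \<open>P\<close> and \<open>Q\<close> agree at two possibly different points near
      \<open>x\<close>; each value is within \<open>e / 2\<close> of the one at
      \<open>x\<close>.\<close>
    have "h\<^sup>2 * P (x + s *\<^sub>R axis j 1 + t *\<^sub>R axis k 1) = h\<^sup>2 * Q (x + s' *\<^sub>R axis k 1 + t' *\<^sub>R axis j 1)"
      unfolding st(5)[symmetric] st'(5)[symmetric] by (simp add: algebra_simps)
    then have "P (x + s *\<^sub>R axis j 1 + t *\<^sub>R axis k 1) = Q (x + s' *\<^sub>R axis k 1 + t' *\<^sub>R axis j 1)"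
      using h by simp
    moreover have "dist (P (x + s *\<^sub>R axis j 1 + t *\<^sub>R axis k 1)) (P x) < e / 2"
      "dist (Q (x + s' *\<^sub>R axis k 1 + t' *\<^sub>R axis j 1)) (Q x) < e / 2"
      using near box st(1-4) st'(1-4) by (meson less_imp_le)+
    ultimately show ?thesis
      unfolding dist_real_def by argo
  qed
  then have "P x = Q x"
    using field_le_epsilon[of "\<bar>P x - Q x\<bar>" 0] by simp
  then have "b \<bullet> b = 0"
    by (simp add: P_def Q_def b_def inner_diff_left)
  then show ?thesis
    by (simp add: b_def)
qed

text \<open>The norm of a quaternion is that of the tuple of its coefficients, so the constructor is
  a linear isometry on tuples and derivatives may be taken componentwise.\<close>

lemma has_vector_derivative_CQuat:
  assumes "(a has_vector_derivative a') (at t)" "(b has_vector_derivative b') (at t)"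
    "(c has_vector_derivative c') (at t)" "(d has_vector_derivative d') (at t)"
  shows "((\<lambda>s. CQuat (a s) (b s) (c s) (d s)) has_vector_derivative CQuat a' b' c' d') (at t)"
proof -
  have "bounded_linear (\<lambda>(a, b, c, d). CQuat a b c d)"
    by (rule bounded_linear_intro[of _ 1]) (auto simp: cquat_eq_iff norm_cquat_tuple)
  from bounded_linear.has_vector_derivative[OF this, of "\<lambda>s. (a s, b s, c s, d s)" "(a', b', c', d')"]
  show ?thesis
    using assms by (simp add: has_vector_derivative_Pair)
qed

lemma partial_log_deriv:
  assumes "open S" "C2_on S u" "\<And>y. y \<in> S \<Longrightarrow> u y \<noteq> 0" "x \<in> S"
  defines "q \<equiv> \<lambda>k l. (partial k (partial l u) x * u x - partial l u x * partial k u x) / (u x)\<^sup>2"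
  shows "partial k (log_deriv u) x = CQuat 0 (q k 1) (q k 2) (q k 3)"
proof -
  have u: "has_partials_on S u" "has_partials_on S (partial l u)" for l
    using assms(2) by (auto simp: C2_on_def C1_on_def)
  let ?p = "\<lambda>s. x + s *\<^sub>R axis k 1"
  have q: "((\<lambda>s. partial l u (?p s) / u (?p s)) has_vector_derivative q k l) (at 0)" for l
  proof -
    have "((\<lambda>s. partial l u (?p s)) has_vector_derivative partial k (partial l u) x) (at 0)"
      "((\<lambda>s. u (?p s)) has_vector_derivative partial k u x) (at 0)"
      using has_vector_derivative_partial[OF u(2), of x 0] has_vector_derivative_partial[OF u(1), of x 0]
        assms(4) by simp_all
    then show ?thesis
      using assms(3)[OF assms(4)] unfolding has_vector_derivative_def q_def
      by (auto intro!: derivative_eq_intros simp: fun_eq_iff field_simps power2_eq_square scaleR_conv_of_real)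
  qed
  have "((\<lambda>s. CQuat 0 (partial 1 u (?p s) / u (?p s)) (partial 2 u (?p s) / u (?p s))
        (partial 3 u (?p s) / u (?p s))) has_vector_derivative CQuat 0 (q k 1) (q k 2) (q k 3)) (at 0)"
    by (intro has_vector_derivative_CQuat q) simp
  \<comment> \<open>The component formula for \<open>log_deriv\<close> is known only on
    \<open>S\<close>. The line stays in \<open>S\<close> for parameters in an open set around 0,
    which is enough to carry the derivative over.\<close>
  moreover have "open (?p -` S)"
    by (intro open_vimage assms continuous_intros)
  ultimately have "((\<lambda>s. log_deriv u (?p s)) has_vector_derivative CQuat 0 (q k 1) (q k 2) (q k 3)) (at 0)"
    by (rule has_vector_derivative_transform_within_open)
      (use assms(4) log_deriv_components[OF u(1)] in auto)
  then show ?thesis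
    unfolding partial_def by (rule vector_derivative_at)
qed

lemma moisil_D_log_deriv:
  assumes "open S" "C2_on S u" "\<And>y. y \<in> S \<Longrightarrow> u y \<noteq> 0" "x \<in> S"
  shows "moisil_D (log_deriv u) x + (log_deriv u x)\<^sup>2 = cq_scalar (- laplacian u x / u x)"
proof -
  have u: "has_partials_on S u"
    using assms(2) by (simp add: C2_on_def C1_on_def)
  have sq: "(log_deriv u x)\<^sup>2 =
      cq_scalar (- ((partial 1 u x / u x)\<^sup>2 + (partial 2 u x / u x)\<^sup>2 + (partial 3 u x / u x)\<^sup>2))"
    using vector_square[of "log_deriv u x"] by (simp add: log_deriv_components[OF u assms(4)])
  note comm = partial_commute[OF assms(1,2,4)]
  have D: "partial k (log_deriv u) x = CQuat 0
      ((partial k (partial 1 u) x * u x - partial 1 u x * partial k u x) / (u x)\<^sup>2)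
      ((partial k (partial 2 u) x * u x - partial 2 u x * partial k u x) / (u x)\<^sup>2)
      ((partial k (partial 3 u) x * u x - partial 3 u x * partial k u x) / (u x)\<^sup>2)" for k
    using assms by (rule partial_log_deriv)
  \<comment> \<open>Component 0 is minus the divergence plus the square, where the squared first
    partials cancel. Components 1 to 3 form the curl: the products of first partials cancel in
    pairs, and \<open>comm\<close> removes the mixed second partials.\<close>
  show ?thesis
    using assms(3)[OF assms(4)] comm[of 1 2] comm[of 1 3] comm[of 2 3]
    unfolding moisil_D_def sq D
    by (simp add: cquat_eq_iff i1_def i2_def i3_def laplacian_def sum_3 field_simps power2_eq_square)
qed

theorem proposition1:
  fixes \<Omega> :: "(real^3) set" and v \<phi> :: "real^3 \<Rightarrow> complex"
  assumes "open \<Omega>" "connected \<Omega>" "\<Omega> \<noteq> {}"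
    and "C2_on \<Omega> \<phi>"
    and "\<And>x. x \<in> \<Omega> \<Longrightarrow> \<phi> x \<noteq> 0"
  shows "(\<forall>x\<in>\<Omega>. laplacian \<phi> x + v x * \<phi> x = 0) \<longleftrightarrow>
         (\<forall>x\<in>\<Omega>. moisil_D (log_deriv \<phi>) x + (log_deriv \<phi> x)\<^sup>2 = cq_scalar (v x))"
\<comment> \<open>The two equations are equivalent at each point separately: division by the nonzero
  value of \<open>\<phi>\<close> turns one into the other.\<close>
proof (intro ball_cong refl)
  fix x assume x: "x \<in> \<Omega>"
  have "laplacian \<phi> x + v x * \<phi> x = 0 \<longleftrightarrow> - laplacian \<phi> x / \<phi> x = v x"
    using assms(5)[OF x] by (auto simp: field_simps add_eq_0_iff)
  then show "laplacian \<phi> x + v x * \<phi> x = 0 \<longleftrightarrow>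
      moisil_D (log_deriv \<phi>) x + (log_deriv \<phi> x)\<^sup>2 = cq_scalar (v x)"
    using moisil_D_log_deriv[OF assms(1,4) _ x] assms(5) by (simp add: cquat_eq_iff)
qed

end
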